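(* Let $M$ be the number of slots, $P_p$ the constant primary transmit power, $P_{int}$ the interference threshold, $\sigma_s^2$ the noise variance, $0\le\eta\le 1$ the harvesting efficiency, and $h_{ss}^i,h_{ps}^i,h_{sp}^i$ ($i=1,\dots,M$) the channel power gains, all known in advance. Put $\theta_i=\dfrac{h_{ss}^i}{\sigma_s^2+h_{ps}^iP_p}$. Consider the convex optimization problem $$\max_{\alpha,E_s}\ \sum_{i=1}^M \alpha_i\log_2\Big(1+\frac{h_{ss}^iE_s^i}{\alpha_i(\sigma_s^2+h_{ps}^iP_p)}\Big)$$ over $\alpha=(\alpha_1,\dots,\alpha_M)$ and $E_s=(E_s^1,\dots,E_s^M)$, subject to $$\text{(a)}\ \sum_{j=1}^iE_s^j\le\sum_{j=1}^i(1-\alpha_j)\eta P_p,\qquad \text{(b)}\ h_{sp}^iE_s^i\le\alpha_iP_{int},\qquad \text{(c)}\ E_s^i\ge 0,\ 0\le\alpha_i\le 1,\qquad i=1,\dots,M.$$ Let $\lambda_i^*,\gamma_i^*,\mu_i^*$ be the optimal dual variables for (a), (b) and $\alpha_i\le 1$ respectively, in the KKT system given in the context (dual variables for the nonnegativity constraints are neglected, and these constraints are included afterwards by projecting the obtained results onto the positive orthant). Then the optimal solution is given, for $i=1,\dots,M$, by $$E_s^{i*}=\alpha_i^*\left[\frac{1}{\ln 2\,\big(\sum_{j=i}^M\lambda_j^*+\gamma_i^*h_{sp}^i\big)}-\frac1{\theta_i}\right]^+,$$ $$\alpha_i^*=\theta_iE_s^{i*}\left[\frac{1}{\ln 2\,\big(\log_2(1+\theta_i\beta_i^*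 )-\sum_{j=i}^M\eta P_p\lambda_j^*+\gamma_i^*P_{int}-\mu_i^*\big)}-1\right]^+,$$ where $$\beta_i^*=\left[\frac{1}{\ln 2\,\big(\sum_{j=i}^M\lambda_j^*+\gamma_i^*h_{sp}^i\big)}-\frac1{\theta_i}\right]^+ .$$ Since the transmit power is $P_s^{i*}=E_s^{i*}/\alpha_i^*$, the optimal transmit power in slot $i$ is $$P_s^{i*}=\begin{cases}\left[\dfrac{1}{\ln 2\,\big(\sum_{j=i}^M\lambda_j^*+\gamma_i^*h_{sp}^i\big)}-\dfrac1{\theta_i}\right]^+, & 0<\alpha_i^*\le 1,\\[2mm] 0, & \alpha_i^*=0.\end{cases}$$
   Context: Notation: $[x]^+=\max(x,0)$. Setting: in each of $M$ slots of length 1 second, a secondary transmitter harvests energy for a fraction $1-\alpha_i$ of the slot from a primary transmitter of constant power $P_p$ with efficiency $\eta$, and transmits during the fraction $\alpha_i$ with power $P_s^i$, consuming energy $E_s^i=\alpha_iP_s^i$. The links are i.i.d. Rayleigh faded, so the channel power gains are exponentially distributed: $h_{ss}^i$ (secondary transmitter to secondary receiver), $h_{ps}^i$ (primary transmitter to secondary receiver), $h_{sp}^i$ (secondary transmitter to primary receiver). They are known non-causally at the secondary transmitter (offline setting). $\sigma_s^2$ is the variance of the Gaussian noise at the secondary receiver. Constraint (a) is energy causality of the secondary user, and (b) is the interference constraint at the primary receiver. Lagrangian: $$\mathcal L=-\sum_{i=1}^M\alpha_i\log_2\Big(1+\frac{\theta_iE_s^i}{\alpha_i}\Big)+\sum_{i=1}^M\lambda_i\Big[\sum_{j=1}^iE_s^j-\sum_{j=1}^i(1-\alpha_j)\eta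 P_p\Big]+\sum_{i=1}^M\gamma_i\big[h_{sp}^iE_s^i-P_{int}\alpha_i\big]+\sum_{i=1}^M\mu_i(\alpha_i-1).$$ KKT stationarity conditions, for $i=1,\dots,M$: $$\frac{\theta_iE_s^{i*}/\alpha_i^*}{\ln 2\,\big(1+\theta_iE_s^{i*}/\alpha_i^*\big)}-\log_2\Big(1+\frac{\theta_iE_s^{i*}}{\alpha_i^*}\Big)+\sum_{j=i}^M\eta P_p\lambda_j^*-P_{int}\gamma_i^*+\mu_i^*=0,$$ $$-\frac{\theta_i}{\ln 2\,\big(1+\theta_iE_s^{i*}/\alpha_i^*\big)}+\sum_{j=i}^M\lambda_j^*+\gamma_i^*h_{sp}^i=0.$$ Complementary slackness, for $i=1,\dots,M$: $\lambda_i^*\big[\sum_{j=1}^iE_s^{j*}-\sum_{j=1}^i(1-\alpha_j^* )\eta P_p\big]=0$, $\gamma_i^*[h_{sp}^iE_s^{i*}-\alpha_i^*P_{int}]=0$, $\mu_i^*[\alpha_i^*-1]=0$. The formulas in the claim are those obtained from the two stationarity conditions, with the $[\cdot]^+$ accounting for the projection onto the positive orthant.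
   Formalization: For η = 0 the formula for α_i* is asserted only where its denominator is nonzero (it is undefined otherwise, as E_s = 0 is forced); P_p, P_int, σ_s², h_ss and h_sp are taken strictly positive, and stationarity is imposed only in slots with α_i* > 0. *)

theory Defs
  imports Complex_Main
begin

text \<open>
  Slots are numbered \<open>1, \<dots>, M\<close>; a slot-indexed quantity is a function on \<open>nat\<close> of which only the
  values on \<open>{1..M}\<close> are used.  The harvesting efficiency is \<open>\<eta>\<close>, \<open>\<sigma>2\<close> is the noise variance
  (not its square root), and the multipliers of (a), (b) and \<open>\<alpha>\<^sub>i \<le> 1\<close> are
  \<open>lam\<close>, \<open>\<gamma>\<close> and \<open>\<mu>\<close>.
\<close>

definition snr_coeff :: "real \<Rightarrow> real \<Rightarrow> (nat \<Rightarrow> real) \<Rightarrow> (nat \<Rightarrow> real) \<Rightarrow> nat \<Rightarrow> real" where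
  "snr_coeff Pp \<sigma>2 hss hps i = hss i / (\<sigma>2 + hps i * Pp)"

text \<open>
  For \<open>\<alpha> i = 0\<close> the summand is \<open>0\<close>.  Constraint (b) then forces \<open>E i = 0\<close> when \<open>hsp i > 0\<close>, so this
  is the continuous extension of the rate along every ray \<open>E i = p * \<alpha> i\<close>.
\<close>

definition sum_rate ::
  "nat \<Rightarrow> real \<Rightarrow> real \<Rightarrow> (nat \<Rightarrow> real) \<Rightarrow> (nat \<Rightarrow> real) \<Rightarrow> (nat \<Rightarrow> real) \<times> (nat \<Rightarrow> real) \<Rightarrow> real"
where
  "sum_rate M Pp \<sigma>2 hss hps = (\<lambda>(\<alpha>, E).
     \<Sum>i = 1..M. \<alpha> i * log 2 (1 + hss i * E i / (\<alpha> i * (\<sigma>2 + hps i * Pp))))"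

definition feasible ::
  "nat \<Rightarrow> real \<Rightarrow> real \<Rightarrow> real \<Rightarrow> (nat \<Rightarrow> real) \<Rightarrow> (nat \<Rightarrow> real) \<times> (nat \<Rightarrow> real) \<Rightarrow> bool"
where
  "feasible M Pp Pint \<eta> hsp = (\<lambda>(\<alpha>, E). \<forall>i\<in>{1..M}.
     (\<Sum>j = 1..i. E j) \<le> (\<Sum>j = 1..i. (1 - \<alpha> j) * \<eta> * Pp) \<and>
     hsp i * E i \<le> \<alpha> i * Pint \<and>
     0 \<le> E i \<and> 0 \<le> \<alpha> i \<and> \<alpha> i \<le> 1)"

definition optimal_solution ::
  "nat \<Rightarrow> real \<Rightarrow> real \<Rightarrow> real \<Rightarrow> real \<Rightarrow> (nat \<Rightarrow> real) \<Rightarrow> (nat \<Rightarrow> real) \<Rightarrow> (nat \<Rightarrow> real) \<Rightarrow>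
   (nat \<Rightarrow> real) \<Rightarrow> (nat \<Rightarrow> real) \<Rightarrow> bool"
where
  "optimal_solution M Pp Pint \<eta> \<sigma>2 hss hps hsp \<alpha> E \<longleftrightarrow>
     is_arg_max (sum_rate M Pp \<sigma>2 hss hps) (feasible M Pp Pint \<eta> hsp) (\<alpha>, E)"

text \<open>
  The Lagrangian (of minus the sum rate) carries no multipliers for \<open>E i \<ge> 0\<close> and \<open>\<alpha> i \<ge> 0\<close>.
\<close>

definition lagrangian ::
  "nat \<Rightarrow> real \<Rightarrow> real \<Rightarrow> real \<Rightarrow> (nat \<Rightarrow> real) \<Rightarrow> (nat \<Rightarrow> real) \<Rightarrow> (nat \<Rightarrow> real) \<Rightarrow> (nat \<Rightarrow> real) \<Rightarrow>
   (nat \<Rightarrow> real) \<Rightarrow> (nat \<Rightarrow> real) \<Rightarrow> (nat \<Rightarrow> real) \<Rightarrow> real"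
where
  "lagrangian M Pp Pint \<eta> \<theta> hsp lam \<gamma> \<mu> \<alpha> E =
     - (\<Sum>i = 1..M. \<alpha> i * log 2 (1 + \<theta> i * E i / \<alpha> i))
     + (\<Sum>i = 1..M. lam i * ((\<Sum>j = 1..i. E j) - (\<Sum>j = 1..i. (1 - \<alpha> j) * \<eta> * Pp)))
     + (\<Sum>i = 1..M. \<gamma> i * (hsp i * E i - Pint * \<alpha> i))
     + (\<Sum>i = 1..M. \<mu> i * (\<alpha> i - 1))"

definition lagrangian_d\<alpha> ::
  "nat \<Rightarrow> real \<Rightarrow> real \<Rightarrow> real \<Rightarrow> (nat \<Rightarrow> real) \<Rightarrow> (nat \<Rightarrow> real) \<Rightarrow> (nat \<Rightarrow> real) \<Rightarrow>
   (nat \<Rightarrow> real) \<Rightarrow> (nat \<Rightarrow> real) \<Rightarrow> (nat \<Rightarrow> real) \<Rightarrow> nat \<Rightarrow> real"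
where
  "lagrangian_d\<alpha> M Pp Pint \<eta> \<theta> lam \<gamma> \<mu> \<alpha> E i =
     (\<theta> i * E i / \<alpha> i) / (ln 2 * (1 + \<theta> i * E i / \<alpha> i)) - log 2 (1 + \<theta> i * E i / \<alpha> i)
     + (\<Sum>j = i..M. \<eta> * Pp * lam j) - Pint * \<gamma> i + \<mu> i"

definition lagrangian_dE ::
  "nat \<Rightarrow> (nat \<Rightarrow> real) \<Rightarrow> (nat \<Rightarrow> real) \<Rightarrow> (nat \<Rightarrow> real) \<Rightarrow>
   (nat \<Rightarrow> real) \<Rightarrow> (nat \<Rightarrow> real) \<Rightarrow> (nat \<Rightarrow> real) \<Rightarrow> nat \<Rightarrow> real"
where
  "lagrangian_dE M \<theta> hsp lam \<gamma> \<alpha> E i =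
     - (\<theta> i / (ln 2 * (1 + \<theta> i * E i / \<alpha> i))) + (\<Sum>j = i..M. lam j) + \<gamma> i * hsp i"

text \<open>
  The Lagrangian is differentiable in slot \<open>i\<close> only for \<open>\<alpha> i > 0\<close> (the quotient \<open>E i / \<alpha> i\<close> is
  meaningless for \<open>\<alpha> i = 0\<close>), so the two stationarity conditions are imposed exactly there.
\<close>

definition kkt_multipliers ::
  "nat \<Rightarrow> real \<Rightarrow> real \<Rightarrow> real \<Rightarrow> (nat \<Rightarrow> real) \<Rightarrow> (nat \<Rightarrow> real) \<Rightarrow> (nat \<Rightarrow> real) \<Rightarrow> (nat \<Rightarrow> real) \<Rightarrow>
   (nat \<Rightarrow> real) \<Rightarrow> (nat \<Rightarrow> real) \<Rightarrow> (nat \<Rightarrow> real) \<Rightarrow> bool"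
where
  "kkt_multipliers M Pp Pint \<eta> \<theta> hsp \<alpha> E lam \<gamma> \<mu> \<longleftrightarrow> (\<forall>i\<in>{1..M}.
     0 \<le> lam i \<and> 0 \<le> \<gamma> i \<and> 0 \<le> \<mu> i \<and>
     (0 < \<alpha> i \<longrightarrow> lagrangian_d\<alpha> M Pp Pint \<eta> \<theta> lam \<gamma> \<mu> \<alpha> E i = 0) \<and>
     (0 < \<alpha> i \<longrightarrow> lagrangian_dE M \<theta> hsp lam \<gamma> \<alpha> E i = 0) \<and>
     lam i * ((\<Sum>j = 1..i. E j) - (\<Sum>j = 1..i. (1 - \<alpha> j) * \<eta> * Pp)) = 0 \<and>
     \<gamma> i * (hsp i * E i - \<alpha> i * Pint) = 0 \<and>
     \<mu> i * (\<alpha> i - 1) = 0)"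

text \<open>
  For \<open>\<eta> = 0\<close> energy causality forces \<open>E = 0\<close>, every \<open>\<alpha>\<close> is optimal, and in a stationary slot with
  \<open>\<alpha> i > 0\<close> the closed formula for \<open>\<alpha> i\<close> reads \<open>0 * (1/0 - 1)\<close>.  The theorem asserts that formula
  without restriction for \<open>\<eta> > 0\<close>, and for \<open>\<eta> = 0\<close> wherever its denominator is nonzero.

  Transmit power is energy per active time, and \<open>0\<close> in a slot without transmission.
\<close>

definition transmit_power :: "(nat \<Rightarrow> real) \<Rightarrow> (nat \<Rightarrow> real) \<Rightarrow> nat \<Rightarrow> real" where
  "transmit_power \<alpha> E i = (if \<alpha> i = 0 then 0 else E i / \<alpha> i)"

lemma sum_prefix_delta:
  fixes lam :: "nat \<Rightarrow> real"
  assumes "i \<in> {1..M}"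
  shows "(\<Sum>k = 1..M. lam k * (\<Sum>j = 1..k. if j = i then c else 0)) = (\<Sum>k = i..M. c * lam k)"
proof -
  have "(\<Sum>k = 1..M. lam k * (\<Sum>j = 1..k. if j = i then c else 0))
      = (\<Sum>k = 1..M. if i \<le> k then c * lam k else 0)"
    using assms by (intro sum.cong) (auto simp: sum.delta)
  also have "\<dots> = (\<Sum>k \<in> {1..M} \<inter> {k. i \<le> k}. c * lam k)"
    by (simp add: sum.inter_restrict)
  also have "{1..M} \<inter> {k. i \<le> k} = {i..M}"
    using assms by auto
  finally show ?thesis .
qed

lemma lagrangian_has_derivative_\<alpha>:
  assumes i: "i \<in> {1..M}" and a: "0 < \<alpha> i" and x: "0 < 1 + \<theta> i * E i / \<alpha> i"
  shows "((\<lambda>a. lagrangian M Pp Pint \<eta> \<theta> hsp lam \<gamma> \<mu> (\<alpha>(i := a)) E) has_real_derivative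
           lagrangian_d\<alpha> M Pp Pint \<eta> \<theta> lam \<gamma> \<mu> \<alpha> E i) (at (\<alpha> i))"
proof -
  let ?x = "\<theta> i * E i / \<alpha> i"
  let ?r = "log 2 (1 + ?x) - ?x / (ln 2 * (1 + ?x))"
  have u: "((\<lambda>a. (\<alpha>(i := a)) j) has_real_derivative (if j = i then 1 else 0)) (at (\<alpha> i))" for j
    by (cases "j = i") auto
  have r: "((\<lambda>a. (\<alpha>(i := a)) j * log 2 (1 + \<theta> j * E j / (\<alpha>(i := a)) j)) has_real_derivative
             (if j = i then ?r else 0)) (at (\<alpha> i))" for j
  proof (cases "j = i")
    case True
    have "((\<lambda>a. a * (ln (1 + \<theta> i * E i / a) / ln 2)) has_real_derivative
            (ln (1 + ?x) / ln 2 + \<alpha> i * ((- (\<theta> i * E i) / (\<alpha> i)\<^sup>2) / (1 + ?x) / ln 2))) (at (\<alpha> i))"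
      using a x by (auto intro!: derivative_eq_intros simp: power2_eq_square diff_divide_distrib mult_ac)
    moreover have "\<alpha> i * ((- (\<theta> i * E i) / (\<alpha> i)\<^sup>2) / (1 + ?x) / ln 2) = - (?x / (ln 2 * (1 + ?x)))"
      using a by (simp add: power2_eq_square mult.commute)
    ultimately show ?thesis using True by (simp add: log_def)
  qed simp
  have deriv: "((\<lambda>a. lagrangian M Pp Pint \<eta> \<theta> hsp lam \<gamma> \<mu> (\<alpha>(i := a)) E) has_real_derivative
      - (\<Sum>j = 1..M. if j = i then ?r else 0)
      + (\<Sum>k = 1..M. lam k * (0 - (\<Sum>j = 1..k. (0 - (if j = i then 1 else 0)) * \<eta> * Pp)))
      + (\<Sum>j = 1..M. \<gamma> j * (0 - Pint * (if j = i then 1 else 0)))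
      + (\<Sum>j = 1..M. \<mu> j * ((if j = i then 1 else 0) - 0))) (at (\<alpha> i))"
    unfolding lagrangian_def
    by (intro DERIV_add DERIV_minus DERIV_sum DERIV_cmult DERIV_cmult_right DERIV_diff DERIV_const u r)
  have sums: "(\<Sum>k = 1..M. lam k * (0 - (\<Sum>j = 1..k. (0 - (if j = i then 1 else 0)) * \<eta> * Pp)))
      = (\<Sum>j = i..M. \<eta> * Pp * lam j)"
    unfolding sum_prefix_delta[OF i, symmetric] sum_negf[symmetric] diff_0
    by (intro sum.cong refl arg_cong2[where f = "(*)"]) auto
  have deltas: "(\<Sum>j = 1..M. \<gamma> j * (0 - Pint * (if j = i then 1 else 0))) = - (Pint * \<gamma> i)"
    "(\<Sum>j = 1..M. \<mu> j * ((if j = i then 1 else 0) - 0)) = \<mu> i"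
    "(\<Sum>j = 1..M. if j = i then ?r else 0) = ?r"
    using i by (simp_all add: if_distrib[of "\<lambda>z. _ * z"] sum.delta sum_negf cong: if_cong)
  show ?thesis
    by (rule DERIV_cong[OF deriv]) (unfold sums deltas lagrangian_d\<alpha>_def, simp only: ac_simps diff_conv_add_uminus minus_add_distrib minus_minus)
qed

lemma lagrangian_has_derivative_E:
  assumes i: "i \<in> {1..M}" and a: "0 < \<alpha> i" and x: "0 < 1 + \<theta> i * E i / \<alpha> i"
  shows "((\<lambda>e. lagrangian M Pp Pint \<eta> \<theta> hsp lam \<gamma> \<mu> \<alpha> (E(i := e))) has_real_derivative
           lagrangian_dE M \<theta> hsp lam \<gamma> \<alpha> E i) (at (E i))"
proof -
  let ?r = "\<theta> i / (ln 2 * (1 + \<theta> i * E i / \<alpha> i))"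
  have u: "((\<lambda>e. (E(i := e)) j) has_real_derivative (if j = i then 1 else 0)) (at (E i))" for j
    by (cases "j = i") auto
  have r: "((\<lambda>e. \<alpha> j * log 2 (1 + \<theta> j * (E(i := e)) j / \<alpha> j)) has_real_derivative
             (if j = i then ?r else 0)) (at (E i))" for j
  proof (cases "j = i")
    case True
    have "((\<lambda>e. \<alpha> i * (ln (1 + \<theta> i * e / \<alpha> i) / ln 2)) has_real_derivative
            \<alpha> i * ((\<theta> i / \<alpha> i) / (1 + \<theta> i * E i / \<alpha> i) / ln 2)) (at (E i))"
      using a x by (auto intro!: derivative_eq_intros)
    moreover have "\<alpha> i * ((\<theta> i / \<alpha> i) / (1 + \<theta> i * E i / \<alpha> i) / ln 2) = ?r"
      using a by (simp add: mult.commute)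
    ultimately show ?thesis using True by (simp add: log_def)
  qed simp
  have "((\<lambda>e. lagrangian M Pp Pint \<eta> \<theta> hsp lam \<gamma> \<mu> \<alpha> (E(i := e))) has_real_derivative
      - (\<Sum>j = 1..M. if j = i then ?r else 0)
      + (\<Sum>k = 1..M. lam k * ((\<Sum>j = 1..k. if j = i then 1 else 0) - 0))
      + (\<Sum>j = 1..M. \<gamma> j * (hsp j * (if j = i then 1 else 0) - 0))
      + 0) (at (E i))"
    unfolding lagrangian_def
    by (intro DERIV_add DERIV_minus DERIV_sum DERIV_cmult DERIV_diff DERIV_const u r)
  moreover have "(\<Sum>k = 1..M. lam k * ((\<Sum>j = 1..k. if j = i then 1 else 0) - 0))
      = (\<Sum>j = i..M. lam j)"
    using sum_prefix_delta[OF i, of lam 1] by simp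
  moreover have "(\<Sum>j = 1..M. \<gamma> j * (hsp j * (if j = i then 1 else 0) - 0)) = \<gamma> i * hsp i"
    "(\<Sum>j = 1..M. if j = i then ?r else 0) = ?r"
    using i by (simp_all add: if_distrib[of "\<lambda>z. _ * z"] sum.delta cong: if_cong)
  ultimately show ?thesis
    by (simp add: lagrangian_dE_def)
qed

end

theory Submission
  imports Defs
begin

text \<open>
  In a slot with \<open>\<alpha> i > 0\<close>, put \<open>x = \<theta> i * E i / \<alpha> i\<close>.  Stationarity in \<open>E\<close> can be solved for \<open>x\<close>,
  and stationarity in \<open>\<alpha>\<close> says that the denominator \<open>Q\<close> of the formula for \<open>\<alpha> i\<close> satisfies
  \<open>ln 2 * Q = x / (1 + x)\<close>, so that \<open>1 / (ln 2 * Q) - 1 = 1 / x\<close> unless \<open>x = 0\<close>.  That case is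
  impossible for \<open>\<eta> > 0\<close>: an idle slot has \<open>\<gamma> i = 0\<close> by slackness of (b), the \<open>\<alpha>\<close>-condition then
  makes all \<open>lam j\<close> with \<open>j \<ge> i\<close> vanish, and the \<open>E\<close>-condition would give \<open>\<theta> i = 0\<close>.  In a slot with
  \<open>\<alpha> i = 0\<close>, constraint (b) forces \<open>E i = 0\<close>.
\<close>

text \<open>Solving the condition for the bracket gives exactly \<open>E i / \<alpha> i\<close>,
  which is nonnegative, so the projection onto the positive orthant changes nothing.\<close>

lemma stationary_power:
  assumes "lagrangian_dE M \<theta> hsp lam \<gamma> \<alpha> E i = 0"
    and "0 < \<alpha> i" "0 \<le> E i" "0 < \<theta> i"
  shows "max (1 / (ln 2 * ((\<Sum>j = i..M. lam j) + \<gamma> i * hsp i)) - 1 / \<theta> i) 0 = E i / \<alpha> i"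
proof -
  define x where "x = \<theta> i * E i / \<alpha> i"
  have x: "0 \<le> x"
    using assms by (simp add: x_def)
  have "(\<Sum>j = i..M. lam j) + \<gamma> i * hsp i = \<theta> i / (ln 2 * (1 + x))"
    using assms(1) by (simp add: lagrangian_dE_def x_def)
  then have "1 / (ln 2 * ((\<Sum>j = i..M. lam j) + \<gamma> i * hsp i)) - 1 / \<theta> i = x / \<theta> i"
    using x \<open>0 < \<theta> i\<close> by (simp add: field_simps)
  also have "x / \<theta> i = E i / \<alpha> i"
    using \<open>0 < \<theta> i\<close> by (simp add: x_def)
  finally show ?thesis
    using assms by simp
qed

text \<open>The logarithm contains \<open>E i / \<alpha> i\<close> where the claim has
  \<open>\<beta> i\<close>; \<open>stationary_power\<close> identifies the two.\<close>

lemma stationary_time_fraction: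
  assumes "lagrangian_d\<alpha> M Pp Pint \<eta> \<theta> lam \<gamma> \<mu> \<alpha> E i = 0"
    and "0 < \<alpha> i" "0 < E i" "0 < \<theta> i"
  shows "\<alpha> i = \<theta> i * E i *
    max (1 / (ln 2 * (log 2 (1 + \<theta> i * (E i / \<alpha> i)) - (\<Sum>j = i..M. \<eta> * Pp * lam j)
      + \<gamma> i * Pint - \<mu> i)) - 1) 0"
proof -
  define x where "x = \<theta> i * E i / \<alpha> i"
  have x: "0 < x"
    using assms by (simp add: x_def)
  have "log 2 (1 + x) - (\<Sum>j = i..M. \<eta> * Pp * lam j) + \<gamma> i * Pint - \<mu> i = x / (ln 2 * (1 + x))"
    using assms(1) by (simp add: lagrangian_d\<alpha>_def x_def mult.commute[of Pint])
  \<comment> \<open>The factor \<open>ln 2\<close> cancels, leaving (1 + x) / x - 1.\<close>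
  then have "1 / (ln 2 * (log 2 (1 + x) - (\<Sum>j = i..M. \<eta> * Pp * lam j)
      + \<gamma> i * Pint - \<mu> i)) - 1 = 1 / x"
    using x by (simp add: field_simps)
  moreover have "\<theta> i * E i * max (1 / x) 0 = \<alpha> i"
    using x assms by (simp add: x_def)
  ultimately show ?thesis
    by (simp add: x_def)
qed

text \<open>The KKT system of all slots enters because the signs of the later \<open>lam j\<close>
  matter: nonnegative terms sum to zero although the sum of the \<open>lam j\<close> is
  positive.\<close>

lemma stationary_slot_not_idle:
  assumes kkt: "kkt_multipliers M Pp Pint \<eta> \<theta> hsp \<alpha> E lam \<gamma> \<mu>"
    and i: "i \<in> {1..M}" and "0 < \<alpha> i" "0 < \<theta> i" "0 < Pp" "0 < Pint" "0 < \<eta>"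
  shows "E i \<noteq> 0"
proof
  assume E: "E i = 0"
  have lam: "0 \<le> lam j" if "j \<in> {i..M}" for j
    using kkt i that by (auto simp: kkt_multipliers_def)
  have k: "0 \<le> \<mu> i" "lagrangian_d\<alpha> M Pp Pint \<eta> \<theta> lam \<gamma> \<mu> \<alpha> E i = 0"
    "lagrangian_dE M \<theta> hsp lam \<gamma> \<alpha> E i = 0" "\<gamma> i * (hsp i * E i - \<alpha> i * Pint) = 0"
    using kkt i \<open>0 < \<alpha> i\<close> by (auto simp: kkt_multipliers_def)
  have \<gamma>: "\<gamma> i = 0"
    using k(4) E \<open>0 < \<alpha> i\<close> \<open>0 < Pint\<close> by simp
  \<comment> \<open>Both rate terms vanish at \<open>E i = 0\<close>, since log 1 = 0.\<close>
  have "\<eta> * Pp * (\<Sum>j = i..M. lam j) + \<mu> i = 0"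
    using k(2) E \<gamma> by (simp add: lagrangian_d\<alpha>_def sum_distrib_left)
  moreover have "0 < (\<Sum>j = i..M. lam j)"
  proof -
    have "(\<Sum>j = i..M. lam j) = \<theta> i / ln 2"
      using k(3) E \<gamma> by (simp add: lagrangian_dE_def)
    then show ?thesis
      using \<open>0 < \<theta> i\<close> by simp
  qed
  ultimately show False
    using k(1) \<open>0 < \<eta>\<close> \<open>0 < Pp\<close> by (smt (verit) mult_pos_pos)
qed

theorem mainTheorem1:
  fixes M :: nat and Pp Pint \<eta> \<sigma>2 :: real
    and hss hps hsp :: "nat \<Rightarrow> real"
    and \<theta> \<alpha> E lam \<gamma> \<mu> \<beta> :: "nat \<Rightarrow> real"
  assumes "0 < Pp" and "0 < Pint" and "0 < \<sigma>2" and "0 \<le> \<eta>" and "\<eta> \<le> 1"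
    and "\<And>i. i \<in> {1..M} \<Longrightarrow> 0 < hss i"
    and "\<And>i. i \<in> {1..M} \<Longrightarrow> 0 \<le> hps i"
    and "\<And>i. i \<in> {1..M} \<Longrightarrow> 0 < hsp i"
    and "\<theta> = snr_coeff Pp \<sigma>2 hss hps"
    and "optimal_solution M Pp Pint \<eta> \<sigma>2 hss hps hsp \<alpha> E"
    and "kkt_multipliers M Pp Pint \<eta> \<theta> hsp \<alpha> E lam \<gamma> \<mu>"
    and "\<beta> = (\<lambda>i. max (1 / (ln 2 * ((\<Sum>j = i..M. lam j) + \<gamma> i * hsp i)) - 1 / \<theta> i) 0)"
  shows "\<forall>i\<in>{1..M}.
      E i = \<alpha> i * max (1 / (ln 2 * ((\<Sum>j = i..M. lam j) + \<gamma> i * hsp i)) - 1 / \<theta> i) 0 \<and>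
      (0 < \<eta> \<or> log 2 (1 + \<theta> i * \<beta> i) - (\<Sum>j = i..M. \<eta> * Pp * lam j) + \<gamma> i * Pint - \<mu> i \<noteq> 0 \<longrightarrow>
        \<alpha> i = \<theta> i * E i *
          max (1 / (ln 2 * (log 2 (1 + \<theta> i * \<beta> i) - (\<Sum>j = i..M. \<eta> * Pp * lam j)
                              + \<gamma> i * Pint - \<mu> i)) - 1) 0) \<and>
      transmit_power \<alpha> E i =
        (if 0 < \<alpha> i
         then max (1 / (ln 2 * ((\<Sum>j = i..M. lam j) + \<gamma> i * hsp i)) - 1 / \<theta> i) 0
         else 0)"
proof
  fix i assume i: "i \<in> {1..M}"
  have \<theta>: "0 < \<theta> i"
    using assms(1,3) assms(6,7)[OF i] assms(9)
    by (simp add: snr_coeff_def add_pos_nonneg)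
  have feas: "hsp i * E i \<le> \<alpha> i * Pint" "0 \<le> E i" "0 \<le> \<alpha> i"
    using assms(10) i by (auto simp: optimal_solution_def is_arg_max_def feasible_def)
  let ?Q = "log 2 (1 + \<theta> i * \<beta> i) - (\<Sum>j = i..M. \<eta> * Pp * lam j) + \<gamma> i * Pint - \<mu> i"
  let ?p = "max (1 / (ln 2 * ((\<Sum>j = i..M. lam j) + \<gamma> i * hsp i)) - 1 / \<theta> i) 0"
  show "E i = \<alpha> i * ?p \<and>
      (0 < \<eta> \<or> ?Q \<noteq> 0 \<longrightarrow> \<alpha> i = \<theta> i * E i * max (1 / (ln 2 * ?Q) - 1) 0) \<and>
      transmit_power \<alpha> E i = (if 0 < \<alpha> i then ?p else 0)"
  proof (cases "0 < \<alpha> i")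
    case False
    then have "\<alpha> i = 0"
      using feas by simp
    moreover from this have "E i = 0"
      using feas assms(8)[OF i] by (simp add: mult_le_0_iff)
    \<comment> \<open>Each formula becomes 0 = 0, whatever value the brackets take.\<close>
    ultimately show ?thesis
      by (simp add: transmit_power_def)
  next
    case True
    have dE: "lagrangian_dE M \<theta> hsp lam \<gamma> \<alpha> E i = 0"
      and d\<alpha>: "lagrangian_d\<alpha> M Pp Pint \<eta> \<theta> lam \<gamma> \<mu> \<alpha> E i = 0"
      using assms(11) i True by (auto simp: kkt_multipliers_def)
    have p: "?p = E i / \<alpha> i"
      by (rule stationary_power[OF dE True feas(2) \<theta>])
    then have \<beta>: "\<beta> i = E i / \<alpha> i"
      using assms(12) by simp
    have "\<alpha> i = \<theta> i * E i * max (1 / (ln 2 * ?Q) - 1) 0" if "0 < \<eta> \<or> ?Q \<noteq> 0"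
    proof -
      have "E i \<noteq> 0"
      proof
        assume E: "E i = 0"
        \<comment> \<open>Here \<open>\<beta> i = 0\<close>, so the \<alpha>-condition reads
          \<open>- ?Q = 0\<close>. This refutes the second alternative of the premise; the non-idle
          lemma refutes the first.\<close>
        have "?Q = 0"
          using d\<alpha> E \<beta> by (simp add: lagrangian_d\<alpha>_def mult.commute[of Pint])
        moreover have "\<not> 0 < \<eta>"
          using stationary_slot_not_idle[OF assms(11) i True \<theta> assms(1,2)] E by blast
        ultimately show False
          using that by blast
      qed
      then show ?thesis
        using stationary_time_fraction[OF d\<alpha> True _ \<theta>] feas(2) \<beta> by simp
    qed
    then show ?thesis
      using p True by (simp add: transmit_power_def)
  qed
qed

end
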